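(* Assume $\mathsf{MA}(\sigma\text{-centered})$. Let $F$ be a countable field and $E$ a countably infinite-dimensional $F$-vector space with fixed basis $(e_n)_{n\in\omega}$. Then there is a full mad family of block subspaces of $E$.
   Context: $\mathsf{MA}(\sigma\text{-centered})$ is the assertion that for every cardinal $\kappa<\mathfrak{c}$, every $\sigma$-centered poset $\mathbb{P}$, and every collection of at most $\kappa$ dense subsets of $\mathbb{P}$, there is a filter in $\mathbb{P}$ meeting all of them. $F$ is a countable (possibly finite) field, $E$ is a vector space over $F$ of countably infinite dimension, and $(e_n)_{n\in\omega}$ is a fixed $F$-basis of $E$. For $x\in E$, $\mathrm{supp}(x)$ is the (finite) set of $n\in\omega$ such that $e_n$ has nonzero coefficient in the expansion of $x$. For nonzero $x,y\in E$, write $x<y$ if $\max(\mathrm{supp}(x))<\min(\mathrm{supp}(y))$. A block sequence is a sequence $(x_n)$ of nonzero vectors with $x_n<x_{n+1}$ for all $n$; a block subspace is the linear span of an infinite block sequence. $\langle\cdot\rangle$ denotes linear span. $\mathrm{bb}^\infty(E)$ is the set of all infinite block sequences in $E$. For $X,Y\in\mathrm{bb}^\infty(E)$, $X\preceq Y$ means $\langle X\rangle\subseteq\langle Y\rangle$. For $\mathcal{H}\subseteq\mathrm{bb}^\infty(E)$ and $X\in\mathcal{H}$, $\mathcal{H}\restriction X=\{Y\in\mathcal{H}:Y\preceq X\}$. Two infinite-dimensional subspaces $X,Y$ of $E$ are almost disjoint if $X\cap Y$ is finite-dimensional. An almost disjoint family of block subspaces is a set of pairwise almost disjoint block subspaces;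 it is a mad family of block subspaces if it is not properly contained in another such family. For an infinite almost disjoint family $\mathcal{A}$ of subspaces, $\mathcal{H}(\mathcal{A})=\{X\in\mathrm{bb}^\infty(E):\text{there are infinitely many }Y\in\mathcal{A}\text{ with }\dim(\langle X\rangle\cap Y)=\infty\}$. A set $\mathcal{H}\subseteq\mathrm{bb}^\infty(E)$ is full if whenever $D\subseteq E$ (not necessarily a subspace) and $X\in\mathcal{H}$ are such that for every $Y\in\mathcal{H}\restriction X$ there is a $Z\in\mathrm{bb}^\infty(E)$ with $Z\preceq Y$ and $\langle Z\rangle\subseteq D$, then there is a $Z\in\mathcal{H}\restriction X$ with $\langle Z\rangle\subseteq D$. An infinite mad family $\mathcal{A}$ is full if $\mathcal{H}(\mathcal{A})$ is full (so full mad families are infinite by definition). *)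

theory Defs
  imports Complex_Main "HOL-Library.Equipollence" "HOL-Library.Countable_Set"
begin

section \<open>Martin's axiom for \<open>\<sigma>\<close>-centered posets\<close>

text \<open>A poset is a nonempty carrier \<open>P\<close> with a partial order \<open>le\<close>; \<open>(p, q) \<in> le\<close> is read as
  \<open>p \<le> q\<close>, i.e.\ \<open>p\<close> extends \<open>q\<close>.\<close>

definition dense_in :: "'p set \<Rightarrow> 'p rel \<Rightarrow> 'p set \<Rightarrow> bool"
  where "dense_in P le D \<longleftrightarrow> D \<subseteq> P \<and> (\<forall>p\<in>P. \<exists>q\<in>D. (q, p) \<in> le)"

definition centered_in :: "'p set \<Rightarrow> 'p rel \<Rightarrow> 'p set \<Rightarrow> bool"
  where "centered_in P le C \<longleftrightarrow>
    C \<subseteq> P \<and> (\<forall>S. S \<subseteq> C \<and> finite S \<longrightarrow> (\<exists>q\<in>P. \<forall>p\<in>S. (q, p) \<in> le))"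

definition sigma_centered :: "'p set \<Rightarrow> 'p rel \<Rightarrow> bool"
  where "sigma_centered P le \<longleftrightarrow>
    (\<exists>C :: nat \<Rightarrow> 'p set. P = (\<Union>n. C n) \<and> (\<forall>n. centered_in P le (C n)))"

definition filter_in :: "'p set \<Rightarrow> 'p rel \<Rightarrow> 'p set \<Rightarrow> bool"
  where "filter_in P le G \<longleftrightarrow>
    G \<subseteq> P \<and> G \<noteq> {} \<and>
    (\<forall>p\<in>G. \<forall>q\<in>P. (p, q) \<in> le \<longrightarrow> q \<in> G) \<and>
    (\<forall>p\<in>G. \<forall>q\<in>G. \<exists>r\<in>G. (r, p) \<in> le \<and> (r, q) \<in> le)"

text \<open>HOL cannot quantify over all types inside a formula, so the posets range over all those with
  carrier a set of reals, i.e.\ up to isomorphism over all posets of size at most continuum.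
  This version follows from the unrestricted axiom, and by the usual
  Loewenheim-Skolem argument (pass to a subposet of size less than continuum) it is equivalent
  to it.  A family has size at most some \<open>\<kappa> < \<cc>\<close> iff it is strictly smaller than the
  reals, which is what \<open>\<D> \<prec> UNIV\<close> says.\<close>

definition MA_sigma_centered :: bool
  where "MA_sigma_centered \<longleftrightarrow>
    (\<forall>(P :: real set) le. P \<noteq> {} \<and> partial_order_on P le \<and> sigma_centered P le \<longrightarrow>
      (\<forall>\<D>. (\<forall>D\<in>\<D>. dense_in P le D) \<and> \<D> \<prec> (UNIV :: real set) \<longrightarrow>
        (\<exists>G. filter_in P le G \<and> (\<forall>D\<in>\<D>. G \<inter> D \<noteq> {}))))"


section \<open>Block sequences and mad families of block subspaces\<close>

locale countable_based_space = vector_space scale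
  for scale :: "'f::field \<Rightarrow> 'v::ab_group_add \<Rightarrow> 'v" (infixr \<open>*s\<close> 75) +
  fixes e :: "nat \<Rightarrow> 'v"
  assumes countable_field: "countable (UNIV :: 'f set)"
    and inj_e: "inj e"
    and independent_e: "independent (range e)"
    and span_e: "span (range e) = UNIV"
begin

definition supp :: "'v \<Rightarrow> nat set"
  where "supp x = {n. representation (range e) x (e n) \<noteq> 0}"

definition block_less :: "'v \<Rightarrow> 'v \<Rightarrow> bool"
  where "block_less x y \<longleftrightarrow> x \<noteq> 0 \<and> y \<noteq> 0 \<and> Max (supp x) < Min (supp y)"

definition bb :: "(nat \<Rightarrow> 'v) set"
  where "bb = {X. (\<forall>n. X n \<noteq> 0) \<and> (\<forall>n. block_less (X n) (X (Suc n)))}"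

definition seq_span :: "(nat \<Rightarrow> 'v) \<Rightarrow> 'v set"
  where "seq_span X = span (range X)"

definition block_subspace :: "'v set \<Rightarrow> bool"
  where "block_subspace V \<longleftrightarrow> (\<exists>X\<in>bb. V = seq_span X)"

definition block_le :: "(nat \<Rightarrow> 'v) \<Rightarrow> (nat \<Rightarrow> 'v) \<Rightarrow> bool" (infix \<open>\<preceq>\<close> 50)
  where "X \<preceq> Y \<longleftrightarrow> seq_span X \<subseteq> seq_span Y"

definition restrict_below :: "(nat \<Rightarrow> 'v) set \<Rightarrow> (nat \<Rightarrow> 'v) \<Rightarrow> (nat \<Rightarrow> 'v) set"
    (infix \<open>\<restriction>\<close> 60)
  where "H \<restriction> X = {Y \<in> H. Y \<preceq> X}"

text \<open>The library's \<open>dim\<close> is \<open>0\<close> on infinite-dimensional subspaces, so finite dimension is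
  expressed by the existence of a finite basis.\<close>

definition fin_dim :: "'v set \<Rightarrow> bool"
  where "fin_dim V \<longleftrightarrow> (\<exists>B. finite B \<and> independent B \<and> span B = V)"

definition almost_disjoint :: "'v set \<Rightarrow> 'v set \<Rightarrow> bool"
  where "almost_disjoint V W \<longleftrightarrow> fin_dim (V \<inter> W)"

definition ad_family :: "'v set set \<Rightarrow> bool"
  where "ad_family \<A> \<longleftrightarrow> (\<forall>V\<in>\<A>. block_subspace V) \<and>
    (\<forall>V\<in>\<A>. \<forall>W\<in>\<A>. V \<noteq> W \<longrightarrow> almost_disjoint V W)"

definition mad_family :: "'v set set \<Rightarrow> bool"
  where "mad_family \<A> \<longleftrightarrow> ad_family \<A> \<and> \<not> (\<exists>\<B>. ad_family \<B> \<and> \<A> \<subset> \<B>)"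

definition coideal :: "'v set set \<Rightarrow> (nat \<Rightarrow> 'v) set"
  where "coideal \<A> = {X \<in> bb. infinite {Y \<in> \<A>. \<not> fin_dim (seq_span X \<inter> Y)}}"

definition full :: "(nat \<Rightarrow> 'v) set \<Rightarrow> bool"
  where "full H \<longleftrightarrow>
    (\<forall>(D :: 'v set) X. X \<in> H \<and>
      (\<forall>Y \<in> H \<restriction> X. \<exists>Z\<in>bb. Z \<preceq> Y \<and> seq_span Z \<subseteq> D) \<longrightarrow>
      (\<exists>Z \<in> H \<restriction> X. seq_span Z \<subseteq> D))"

definition full_mad_family :: "'v set set \<Rightarrow> bool"
  where "full_mad_family \<A> \<longleftrightarrow> infinite \<A> \<and> mad_family \<A> \<and> full (coideal \<A>)"

end

end

theory Submission
  imports Defs "HOL-Analysis.Abstract_Topology_2" "HOL-Library.Sublist"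
begin

text \<open>
  Tasks \<open>(X, D)\<close> are enumerated in order type \<open>\<cc>\<close> and \<open>\<A>\<close> is built by recursion, with fewer than
  \<open>\<cc>\<close> members at every stage.  At the stage of \<open>(X, D)\<close>, if some block sequence \<open>W \<preceq> X\<close> is almost
  disjoint from everything chosen so far, let \<open>Y \<preceq> W\<close> have \<open>\<langle>Y\<rangle> \<subseteq> D\<close> if that is possible, and
  \<open>Y = W\<close> otherwise; then add infinitely many pairwise almost disjoint block subspaces of \<open>\<langle>Y\<rangle>\<close>.
  This puts \<open>Y\<close> into \<open>\<H>(\<A>)\<close>, either as a witness for the conclusion of fullness or as a
  counterexample to its hypothesis.

  If \<open>X \<in> \<H>(\<A>)\<close>, such a \<open>W\<close> exists at every stage: either infinitely many of the members chosen so
  far meet \<open>\<langle>X\<rangle>\<close> in infinite dimension, and Martin's axiom yields \<open>W\<close>, or some member added later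
  does, and \<open>W\<close> can be taken inside it.  Maximality is the case \<open>D = E\<close>: if \<open>\<langle>X\<rangle>\<close> were almost
  disjoint from all of \<open>\<A>\<close>, then \<open>W = X\<close> would qualify, and the pieces of \<open>Y\<close> would be members of
  \<open>\<A>\<close> inside \<open>\<langle>X\<rangle>\<close>.
\<close>

section \<open>Supports, dimension and block sequences\<close>

context countable_based_space
begin

lemma finite_supp: "finite (supp x)"
proof -
  have "finite (e -` {b. representation (range e) x b \<noteq> 0})"
    using finite_representation inj_e by (rule finite_vimageI)
  then show ?thesis
    by (simp add: supp_def vimage_def)
qed

text \<open>The representation over \<open>range e\<close> agrees with the one over any subset that
  already spans the vector. Bounds on supports thus become membership in a span.\<close>

lemma supp_subset_iff: "supp x \<subseteq> I \<longleftrightarrow> x \<in> span (e ` I)"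
proof
  assume I: "supp x \<subseteq> I"
  have "(\<Sum>b | representation (range e) x b \<noteq> 0. representation (range e) x b *s b) = x"
    using independent_e span_e by (simp add: sum_nonzero_representation_eq)
  moreover have "b \<in> e ` I" if "representation (range e) x b \<noteq> 0" for b
    using I representation_ne_zero[OF that] that by (auto simp: supp_def)
  then have "(\<Sum>b | representation (range e) x b \<noteq> 0. representation (range e) x b *s b)
      \<in> span (e ` I)"
    by (intro span_sum span_scale span_base) auto
  ultimately show "x \<in> span (e ` I)"
    by simp
next
  assume "x \<in> span (e ` I)"
  then have "representation (range e) x = representation (e ` I) x"
    using independent_e by (intro representation_extend) auto
  then show "supp x \<subseteq> I"
    using representation_ne_zero[of "e ` I" x] inj_image_mem_iff[OF inj_e, of _ I]
    by (auto simp: supp_def)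
qed

lemma supp_eq_empty_iff: "supp x = {} \<longleftrightarrow> x = 0"
  using supp_subset_iff[of x "{}"] by simp

lemma supp_subset_of_span:
  assumes "x \<in> span S" "\<And>y. y \<in> S \<Longrightarrow> supp y \<subseteq> I"
  shows "supp x \<subseteq> I"
proof -
  have "S \<subseteq> span (e ` I)"
    using assms(2) supp_subset_iff by blast
  then show ?thesis
    using assms(1) span_minimal supp_subset_iff by blast
qed

text \<open>Every vector is the sum of a finite list of (coefficient, index) pairs. Countability is
  what makes the poset sigma-centered and lets conditions and tasks be coded by reals.\<close>

lemma countable_vectors: "countable (UNIV :: 'v set)"
proof -
  let ?L = "lists (UNIV :: ('f \<times> nat) set)"
  let ?s = "\<lambda>xs. sum_list (map (\<lambda>(c, n). c *s e n) xs)"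
  have "x \<in> ?s ` ?L" if "x \<in> span (range e)" for x
    using that
  proof (induction rule: span_induct_alt)
    case base
    then show ?case by (intro image_eqI[of _ _ "[]"]) auto
  next
    case (step c b y)
    then obtain n xs where "b = e n" "y = ?s xs" by auto
    then show ?case by (intro image_eqI[of _ _ "(c, n) # xs"]) auto
  qed
  then have "UNIV \<subseteq> ?s ` ?L"
    using span_e by auto
  moreover have "countable (UNIV \<times> UNIV :: ('f \<times> nat) set)"
    using countable_field by (intro countable_SIGMA) auto
  then have "countable ?L"
    by (intro countable_lists) simp
  ultimately show ?thesis
    by (meson countable_image countable_subset)
qed

section \<open>Finite-dimensional subspaces and vectors with far support\<close>

lemma fin_dim_iff:
  assumes "subspace V"
  shows "fin_dim V \<longleftrightarrow> (\<exists>T. finite T \<and> V \<subseteq> span T)"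
proof
  assume "\<exists>T. finite T \<and> V \<subseteq> span T"
  then obtain T where T: "finite T" "V \<subseteq> span T" by blast
  obtain B where B: "B \<subseteq> V" "independent B" "V \<subseteq> span B"
    using maximal_independent_subset by blast
  have "finite B"
    using independent_span_bound[OF T(1) B(2)] B(1) T(2) by auto
  moreover have "span B = V"
    using B assms by (simp add: span_subspace)
  ultimately show "fin_dim V"
    using B(2) by (auto simp: fin_dim_def)
qed (auto simp: fin_dim_def)

lemma fin_dim_zero: "fin_dim {0}"
  by (subst fin_dim_iff) auto

lemma fin_dim_subset:
  assumes "fin_dim V" "W \<subseteq> V" "subspace W"
  shows "fin_dim W"
  using assms fin_dim_iff[OF assms(3)] by (auto simp: fin_dim_def)

lemma fin_dim_supp_bounded:
  assumes "fin_dim V"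
  obtains N where "\<And>x. x \<in> V \<Longrightarrow> supp x \<subseteq> {..N}"
proof -
  obtain B where B: "finite B" "span B = V"
    using assms by (auto simp: fin_dim_def)
  then have "finite (\<Union>b\<in>B. supp b)"
    using finite_supp by blast
  then obtain N where "(\<Union>b\<in>B. supp b) \<subseteq> {..N}"
    using finite_nat_iff_bounded_le by blast
  then have "supp x \<subseteq> {..N}" if "x \<in> V" for x
    using B(2) that by (intro supp_subset_of_span[of x B]) auto
  then show thesis
    by (rule that)
qed

text \<open>One new generator raises the dimension of the intersection by at most one: if some
  \<open>y\<close> in it involves \<open>w\<close>, subtracting a multiple of \<open>y\<close>
  removes \<open>w\<close> from any other element.\<close>

lemma fin_dim_span_insert_Int:
  assumes "subspace Y" "fin_dim (span V \<inter> Y)"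
  shows "fin_dim (span (insert w V) \<inter> Y)"
proof -
  have sub: "subspace (span (insert w V) \<inter> Y)"
    using assms(1) by (simp add: subspace_inter)
  show ?thesis
  proof (cases "span (insert w V) \<inter> Y \<subseteq> span V")
    case True
    then show ?thesis
      using fin_dim_subset[OF assms(2) _ sub] by blast
  next
    case False
    then obtain y c where y: "y \<in> Y" "y \<notin> span V" "y - c *s w \<in> span V"
      by (auto simp: span_insert)
    have c: "c \<noteq> 0"
      using y by auto
    obtain T where T: "finite T" "span V \<inter> Y \<subseteq> span T"
      using assms fin_dim_iff by (meson subspace_inter subspace_span)
    have "z \<in> span (insert y T)" if "z \<in> Y" "z - d *s w \<in> span V" for z d
    proof -
      have "(z - d *s w) - (d / c) *s (y - c *s w) \<in> span V"
        by (intro span_diff span_scale that y)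
      also have "(z - d *s w) - (d / c) *s (y - c *s w) = z - (d / c) *s y"
        using c by (simp add: scale_right_diff_distrib)
      finally have "z - (d / c) *s y \<in> span V \<inter> Y"
        using that y assms(1) by (simp add: subspace_diff subspace_scale)
      then show ?thesis
        using T(2) by (auto simp: span_insert)
    qed
    then have "span (insert w V) \<inter> Y \<subseteq> span (insert y T)"
      by (auto simp: span_insert[of w V])
    then show ?thesis
      using T(1) fin_dim_iff[OF sub] by blast
  qed
qed

lemma fin_dim_span_Un_Int:
  assumes "finite T" "subspace Y" "fin_dim (span V \<inter> Y)"
  shows "fin_dim (span (V \<union> T) \<inter> Y)"
  using assms(1) by induction (auto simp: assms fin_dim_span_insert_Int)

text \<open>The span of the \<open>e n\<close> with \<open>n > N\<close> meets \<open>V\<close> in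
  infinite dimension; otherwise adding back the finitely many other basis vectors would make
  \<open>V\<close> finite-dimensional.\<close>

lemma infinite_dim_far_vector:
  assumes "subspace V" "\<not> fin_dim V"
  obtains x where "x \<in> V" "x \<noteq> 0" "supp x \<subseteq> {N<..}"
proof -
  have "e ` {N<..} \<union> e ` {..N} = range e"
    by (auto simp: image_Un[symmetric])
  then have "\<not> fin_dim (span (e ` {N<..}) \<inter> V)"
    using fin_dim_span_Un_Int[of "e ` {..N}" V "e ` {N<..}"] assms span_e by auto
  then have "span (e ` {N<..}) \<inter> V \<noteq> {0}"
    using fin_dim_zero by metis
  then obtain x where "x \<in> span (e ` {N<..}) \<inter> V" "x \<noteq> 0"
    using assms(1) subspace_0 span_zero by blast
  then show thesis
    using supp_subset_iff that by blast
qed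

section \<open>The block order and block sequences\<close>

lemma block_less_iff:
  "block_less x y \<longleftrightarrow> x \<noteq> 0 \<and> y \<noteq> 0 \<and> (\<forall>m\<in>supp x. \<forall>n\<in>supp y. m < n)"
proof (cases "x = 0 \<or> y = 0")
  case False
  then have "supp x \<noteq> {}" "supp y \<noteq> {}"
    by (auto simp: supp_eq_empty_iff)
  then show ?thesis
    using False finite_supp[of x] finite_supp[of y]
    by (auto simp: block_less_def Max_less_iff Min_gr_iff)
qed (auto simp: block_less_def)

lemma block_less_trans: "block_less x y \<Longrightarrow> block_less y z \<Longrightarrow> block_less x z"
  unfolding block_less_iff by (metis all_not_in_conv less_trans supp_eq_empty_iff)

lemma block_less_irrefl: "\<not> block_less x x"
  unfolding block_less_iff by (metis all_not_in_conv less_irrefl supp_eq_empty_iff)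

lemma bb_iff: "X \<in> bb \<longleftrightarrow> (\<forall>n. block_less (X n) (X (Suc n)))"
  by (auto simp: bb_def block_less_def)

lemma bb_less:
  assumes "X \<in> bb" "m < n"
  shows "block_less (X m) (X n)"
  using assms(2)
proof (induction rule: less_Suc_induct)
  case (1 i)
  then show ?case using assms(1) by (simp add: bb_iff)
next
  case (2 i j k)
  then show ?case using block_less_trans by blast
qed

lemma bb_subseq:
  assumes "X \<in> bb" "strict_mono f"
  shows "X \<circ> f \<in> bb"
  using assms by (simp add: bb_iff[of "X \<circ> f"] bb_less strict_mono_Suc_iff)

lemma inj_bb:
  assumes "X \<in> bb"
  shows "inj X"
  using bb_less[OF assms] block_less_irrefl by (metis injI linorder_neqE_nat)

text \<open>A finite dependent subset would sit in an initial segment, yet no term lies in the span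
  of the earlier ones, its support being nonempty and disjoint from theirs.\<close>

lemma independent_bb:
  assumes "X \<in> bb"
  shows "independent (range X)"
proof
  assume "dependent (range X)"
  then obtain T where T: "finite T" "T \<subseteq> range X" "dependent T"
    unfolding dependent_explicit by blast
  then obtain I where "finite I" "T = X ` I"
    by (meson finite_subset_image)
  then obtain n where "T \<subseteq> X ` {..<n}"
    by (metis finite_nat_iff_bounded image_mono)
  moreover have "independent (X ` {..<n})"
  proof (induction n)
    case (Suc n)
    have "X n \<notin> span (X ` {..<n})"
    proof
      assume "X n \<in> span (X ` {..<n})"
      then have "supp (X n) \<subseteq> (\<Union>m<n. supp (X m))"
        by (rule supp_subset_of_span) auto
      moreover have "supp (X n) \<inter> supp (X m) = {}" if "m < n" for m
        using bb_less[OF assms that] by (auto simp: block_less_iff)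
      ultimately have "supp (X n) = {}"
        by blast
      then show False
        using assms by (simp add: supp_eq_empty_iff bb_def)
    qed
    then show ?case
      using Suc by (simp add: lessThan_Suc independent_insertI)
  qed (simp add: independent_empty)
  ultimately show False
    using T(3) dependent_mono by blast
qed

lemma subspace_seq_span: "subspace (seq_span X)"
  by (simp add: seq_span_def)

lemma not_fin_dim_seq_span:
  assumes "X \<in> bb"
  shows "\<not> fin_dim (seq_span X)"
proof
  assume "fin_dim (seq_span X)"
  then obtain T where "finite T" "span T = span (range X)"
    by (auto simp: fin_dim_def seq_span_def)
  then have "finite (range X)"
    using independent_span_bound independent_bb[OF assms] by (metis span_superset)
  then show False
    using inj_bb[OF assms] finite_imageD infinite_UNIV_nat by blast
qed

lemma block_subspaceD:
  assumes "block_subspace V"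
  shows "subspace V" "\<not> fin_dim V"
  using assms not_fin_dim_seq_span by (auto simp: block_subspace_def subspace_seq_span)

text \<open>Greedy choice: each next vector of \<open>V\<close> is taken with support beyond that of
  the previous one.\<close>

lemma infinite_dim_block_sequence:
  assumes "subspace V" "\<not> fin_dim V"
  obtains Z where "Z \<in> bb" "seq_span Z \<subseteq> V"
proof -
  have step: "\<exists>y. y \<in> V \<and> y \<noteq> 0 \<and> supp y \<subseteq> {N<..}" for N
    using infinite_dim_far_vector[OF assms] by metis
  have "\<exists>Z. \<forall>n. (Z n \<in> V \<and> Z n \<noteq> 0) \<and> block_less (Z n) (Z (Suc n))"
  proof (rule dependent_nat_choice)
    show "\<exists>x. x \<in> V \<and> x \<noteq> 0"
      using step by blast
  next
    fix x and n :: nat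
    assume x: "x \<in> V \<and> x \<noteq> 0"
    obtain N where "supp x \<subseteq> {..N}"
      using finite_supp finite_nat_iff_bounded_le by blast
    with x step[of N] show "\<exists>y. (y \<in> V \<and> y \<noteq> 0) \<and> block_less x y"
      unfolding block_less_iff by (meson atMost_iff greaterThan_iff order_le_less_trans subsetD)
  qed
  then obtain Z where "Z \<in> bb" "range Z \<subseteq> V"
    by (auto simp: bb_iff)
  then show thesis
    using assms(1) by (intro that[of Z]) (simp_all add: seq_span_def span_minimal)
qed

section \<open>Almost disjoint pieces and one-step extensions\<close>

lemma span_disjoint_Int:
  assumes "independent B" "S \<subseteq> B" "T \<subseteq> B" "S \<inter> T = {}"
  shows "span S \<inter> span T = {0}"
proof -
  have "x = 0" if x: "x \<in> span S" "x \<in> span T" for x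
  proof -
    have "representation S x = representation T x"
      using representation_extend[OF assms(1) x(1) assms(2)]
        representation_extend[OF assms(1) x(2) assms(3)] by simp
    then have "representation S x b = 0" for b
      using representation_ne_zero assms(4) by (metis disjoint_iff)
    moreover have "independent S"
      using assms dependent_mono by blast
    ultimately show ?thesis
      using sum_nonzero_representation_eq[OF _ x(1)] by simp
  qed
  then show ?thesis
    using span_zero by auto
qed

text \<open>The rows of the pairing function split \<open>Y\<close> into infinitely many
  subsequences without common terms. Disjoint subsets of an independent set have spans meeting only
  in 0.\<close>

lemma infinite_disjoint_pieces:
  assumes "Y \<in> bb"
  obtains \<S> where "countable \<S>" "infinite \<S>" "ad_family \<S>" "\<And>V. V \<in> \<S> \<Longrightarrow> V \<subseteq> seq_span Y"
proof
  define f where "f i = (\<lambda>n. prod_encode (i, n))" for i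
  define W where "W i = seq_span (Y \<circ> f i)" for i
  have W: "block_subspace (W i)" for i
  proof -
    have "strict_mono (f i)"
      by (simp add: f_def prod_encode_def strict_mono_Suc_iff)
    then show ?thesis
      using assms bb_subseq by (auto simp: W_def block_subspace_def)
  qed
  have disj: "W i \<inter> W j = {0}" if "i \<noteq> j" for i j
  proof -
    have "range (Y \<circ> f i) \<inter> range (Y \<circ> f j) = {}"
      using that inj_bb[OF assms] by (auto simp: f_def inj_eq)
    then show ?thesis
      unfolding W_def seq_span_def
      using independent_bb[OF assms] by (intro span_disjoint_Int) auto
  qed
  then have "W i \<noteq> W j" if "i \<noteq> j" for i j
    using that W block_subspaceD(2) fin_dim_zero by (metis inf.idem)
  then show "infinite (range W)"
    by (intro range_inj_infinite injI) blast
  show "countable (range W)"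
    by simp
  show "ad_family (range W)"
    unfolding ad_family_def almost_disjoint_def
  proof (intro conjI ballI impI)
    fix V V' assume "V \<in> range W" "V' \<in> range W" "V \<noteq> V'"
    then obtain i j where "V = W i" "V' = W j" "i \<noteq> j"
      by blast
    then show "fin_dim (V \<inter> V')"
      using disj fin_dim_zero by simp
  qed (use W in blast)
  show "V \<subseteq> seq_span Y" if "V \<in> range W" for V
  proof -
    obtain i where "V = span (range (Y \<circ> f i))"
      using \<open>V \<in> range W\<close> by (auto simp: W_def seq_span_def)
    then show ?thesis
      unfolding seq_span_def by (simp only:) (intro span_mono, auto)
  qed
qed

lemma almost_disjoint_commute: "almost_disjoint V W \<longleftrightarrow> almost_disjoint W V"
  by (simp add: almost_disjoint_def Int_commute)

lemma almost_disjoint_subset: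
  assumes "almost_disjoint V W" "subspace V'" "V' \<subseteq> V" "subspace W"
  shows "almost_disjoint V' W"
  using assms(1) unfolding almost_disjoint_def
  by (rule fin_dim_subset) (use assms in \<open>auto intro: subspace_inter\<close>)

text \<open>This lengthens a finite block sequence \<open>T\<close> without adding vectors of the
  members in \<open>\<F>\<close>. Some \<open>Y\<close> outside \<open>\<F>\<close> meets
  \<open>seq_span X\<close> in infinite dimension, while
  \<open>span (V \<union> T) \<inter> Y\<close> is finite-dimensional for each \<open>V\<close> in
  \<open>\<F>\<close>. A far enough \<open>x\<close> in \<open>Y\<close> avoids all these spans, so
  a vector of \<open>V\<close> in \<open>span (insert x T)\<close> has coefficient 0 at
  \<open>x\<close>.\<close>

lemma coideal_extension:
  assumes "ad_family \<A>" "X \<in> coideal \<A>" "finite \<F>" "\<F> \<subseteq> \<A>" "finite T"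
  obtains x where "x \<in> seq_span X" "x \<noteq> 0" "supp x \<subseteq> {N<..}"
    "\<And>V. V \<in> \<F> \<Longrightarrow> span (insert x T) \<inter> V \<subseteq> span T"
proof -
  have "infinite ({Y \<in> \<A>. \<not> fin_dim (seq_span X \<inter> Y)} - \<F>)"
    using assms(2,3) by (simp add: coideal_def)
  then obtain Y where Y: "Y \<in> \<A>" "Y \<notin> \<F>" "\<not> fin_dim (seq_span X \<inter> Y)"
    by (metis (mono_tags, lifting) DiffE ex_in_conv finite.emptyI mem_Collect_eq)
  have sub: "subspace V" if "V \<in> \<A>" for V
    using assms(1) that block_subspaceD by (auto simp: ad_family_def)
  have fd: "fin_dim (span (V \<union> T) \<inter> Y)" if "V \<in> \<F>" for V
  proof (rule fin_dim_span_Un_Int)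
    have "V \<in> \<A>" "V \<noteq> Y"
      using that assms(4) Y by auto
    then show "fin_dim (span V \<inter> Y)"
      using assms(1) Y(1) sub by (auto simp: ad_family_def almost_disjoint_def span_eq_iff[THEN iffD2])
  qed (use assms(5) Y(1) sub in auto)
  have "\<forall>V\<in>\<F>. \<exists>M. \<forall>x \<in> span (V \<union> T) \<inter> Y. supp x \<subseteq> {..M}"
    using fin_dim_supp_bounded[OF fd] by metis
  then obtain M where M: "\<And>V x. V \<in> \<F> \<Longrightarrow> x \<in> span (V \<union> T) \<inter> Y \<Longrightarrow> supp x \<subseteq> {..M V}"
    by metis
  have "subspace (seq_span X \<inter> Y)"
    using Y(1) sub subspace_seq_span subspace_inter by blast
  then obtain x where x: "x \<in> seq_span X \<inter> Y" "x \<noteq> 0" "supp x \<subseteq> {Max (insert N (M ` \<F>))<..}"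
    using infinite_dim_far_vector[OF _ Y(3)] by metis
  have gt: "N < n" "\<And>V. V \<in> \<F> \<Longrightarrow> M V < n" if "n \<in> supp x" for n
    using x(3) that assms(3) by auto
  have far: "x \<notin> span (V \<union> T)" if "V \<in> \<F>" for V
  proof
    assume "x \<in> span (V \<union> T)"
    then have "supp x \<subseteq> {..M V}"
      using M that x(1) by blast
    then have "supp x = {}"
      using gt(2)[OF _ that] by fastforce
    then show False
      using x(2) supp_eq_empty_iff by blast
  qed
  have "z \<in> span T" if V: "V \<in> \<F>" and z: "z \<in> span (insert x T)" "z \<in> V" for V z
  proof -
    obtain k where k: "z - k *s x \<in> span T"
      using z by (auto simp: span_insert)
    have "k = 0"
    proof (rule ccontr)
      assume "k \<noteq> 0"
      have "z - (z - k *s x) \<in> span (V \<union> T)"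
        using z(2) k by (meson UnI1 in_mono span_base span_diff span_mono sup_ge2)
      then have "k *s x \<in> span (V \<union> T)"
        by simp
      then have "(1 / k) *s (k *s x) \<in> span (V \<union> T)"
        by (rule span_scale)
      also have "(1 / k) *s (k *s x) = x"
        using \<open>k \<noteq> 0\<close> by simp
      finally show False
        using far[OF V] by contradiction
    qed
    then show ?thesis
      using k by simp
  qed
  then show thesis
    using x gt by (intro that[of x]) auto
qed

end

section \<open>Martin's axiom on abstract carriers\<close>

text \<open>The axiom speaks only of posets whose carrier is a set of reals. The order is copied
  along \<open>h\<close>, and the filter obtained there is pulled back.\<close>

lemma MA_sigma_centered_transfer:
  includes cardinal_syntax
  fixes h :: "'p \<Rightarrow> real" and P :: "'p set" and le :: "'p rel"
  assumes "MA_sigma_centered" "inj h" "P \<noteq> {}" "partial_order_on P le" "sigma_centered P le"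
    and dense: "\<And>D. D \<in> \<D> \<Longrightarrow> dense_in P le D" and small: "|\<D>| <o |UNIV :: real set|"
  obtains G where "filter_in P le G" "\<And>D. D \<in> \<D> \<Longrightarrow> G \<inter> D \<noteq> {}"
proof -
  define le' where "le' = {(h p, h q) |p q. (p, q) \<in> le}"
  have le': "(h p, h q) \<in> le' \<longleftrightarrow> (p, q) \<in> le" for p q
    using assms(2) by (auto simp: le'_def inj_eq)
  have le'E: "\<exists>p q. x = h p \<and> y = h q \<and> (p, q) \<in> le" if "(x, y) \<in> le'" for x y
    using that by (auto simp: le'_def)
  have po: "partial_order_on (h ` P) le'"
    using assms(4) unfolding partial_order_on_def preorder_on_def
  proof (elim conjE, intro conjI)
    assume "le \<subseteq> P \<times> P" then show "le' \<subseteq> h ` P \<times> h ` P"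
      by (auto simp: le'_def)
  next
    assume "refl_on P le" then show "refl_on (h ` P) le'"
      by (auto simp: refl_on_def le')
  next
    assume "trans le" then show "trans le'"
      using le'E le' by (intro transI) (metis transD)
  next
    assume "antisym le" then show "antisym le'"
      using le'E le' by (intro antisymI) (metis antisymD)
  qed
  have sc: "sigma_centered (h ` P) le'"
  proof -
    obtain C :: "nat \<Rightarrow> 'p set" where C: "P = (\<Union>n. C n)" "\<And>n. centered_in P le (C n)"
      using assms(5) by (auto simp: sigma_centered_def)
    have "centered_in (h ` P) le' (h ` C n)" for n
      unfolding centered_in_def
    proof (intro conjI allI impI)
      fix S assume "S \<subseteq> h ` C n \<and> finite S"
      then obtain S' where S': "S' \<subseteq> C n" "finite S'" "S = h ` S'"
        by (meson finite_subset_image)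
      then obtain q where "q \<in> P" "\<forall>p\<in>S'. (q, p) \<in> le"
        using C(2)[of n] by (auto simp: centered_in_def)
      then show "\<exists>q\<in>h ` P. \<forall>p\<in>S. (q, p) \<in> le'"
        using S' le' by auto
    qed (use C(1) in auto)
    then show ?thesis
      unfolding sigma_centered_def by (intro exI[of _ "\<lambda>n. h ` C n"]) (auto simp: C(1))
  qed
  \<comment> \<open>The bound by cardinal orders is translated into the comparison by injections in
    which the axiom is stated.\<close>
  have "\<not> (UNIV :: real set) \<lesssim> \<D>"
    using small card_of_ordLess[of "UNIV :: real set" \<D>] by (auto simp: lepoll_def)
  moreover have "\<D> \<lesssim> (UNIV :: real set)"
    using ordLess_imp_ordLeq[OF small] card_of_ordLeq[of \<D> "UNIV :: real set"]
    by (auto simp: lepoll_def)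
  ultimately have "\<D> \<prec> (UNIV :: real set)"
    using eqpoll_imp_lepoll eqpoll_sym unfolding lesspoll_def by blast
  then have "(`) h ` \<D> \<prec> (UNIV :: real set)"
    using image_lepoll lesspoll_trans1 by blast
  moreover have "dense_in (h ` P) le' D" if "D \<in> (`) h ` \<D>" for D
    using that dense by (fastforce simp: dense_in_def le')
  ultimately obtain G where G: "filter_in (h ` P) le' G" "\<forall>D\<in>(`) h ` \<D>. G \<inter> D \<noteq> {}"
    using assms(1,3) po sc unfolding MA_sigma_centered_def by (metis image_is_empty)
  then obtain Q where Q: "Q \<subseteq> P" "G = h ` Q"
    by (auto simp: filter_in_def subset_image_iff)
  have "filter_in P le Q"
    unfolding filter_in_def
  proof (intro conjI ballI impI)
    show "Q \<subseteq> P"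
      by (rule Q(1))
    show "Q \<noteq> {}"
      using G(1) by (auto simp: filter_in_def Q(2))
  next
    fix p q assume "p \<in> Q" "q \<in> P" "(p, q) \<in> le"
    then have "h q \<in> G"
      using G(1) Q(2) le' unfolding filter_in_def by blast
    then show "q \<in> Q"
      using Q(2) inj_image_mem_iff[OF assms(2)] by simp
  next
    fix p q assume "p \<in> Q" "q \<in> Q"
    then obtain r where "r \<in> Q" "(h r, h p) \<in> le'" "(h r, h q) \<in> le'"
      using G(1) unfolding filter_in_def Q(2) by blast
    then show "\<exists>r\<in>Q. (r, p) \<in> le \<and> (r, q) \<in> le"
      using le' by blast
  qed
  moreover have "Q \<inter> D \<noteq> {}" if "D \<in> \<D>" for D
    using G(2) that by (auto simp: Q(2) image_Int[OF assms(2), symmetric])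
  ultimately show thesis
    using that by blast
qed

lemma nat_ordLess_real:
  includes cardinal_syntax
  shows "|UNIV :: nat set| <o |UNIV :: real set|"
  using uncountable_UNIV_real card_of_ordLess[of "UNIV :: real set" "UNIV :: nat set"]
  by (auto simp: countable_def)

text \<open>Subsets of a countable type become sets of naturals, and these embed in the reals.
  Conditions and tasks are both coded this way.\<close>

lemma countable_sets_inj_real:
  assumes "countable (UNIV :: 'a set)"
  obtains h :: "'a set \<Rightarrow> real" where "inj h"
proof -
  obtain f :: "'a \<Rightarrow> nat" where f: "inj f"
    using assms by (auto simp: countable_def)
  obtain g :: "nat set \<Rightarrow> real" where g: "inj g"
    using eqpoll_imp_lepoll[OF nat_sets_eqpoll_reals] by (auto simp: lepoll_def)
  have "inj (\<lambda>A. g (f ` A))"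
    using f g by (auto intro!: injI simp: inj_eq inj_image_eq_iff)
  then show thesis
    by (rule that)
qed

context countable_based_space
begin

text \<open>Each vector of \<open>seq_span Z\<close> lies in the span of an initial segment, so a
  bound \<open>T\<close> independent of \<open>n\<close> captures the whole intersection.\<close>

lemma almost_disjoint_seq_spanI:
  assumes "\<And>n. span (Z ` {..<n}) \<inter> V \<subseteq> span T" "finite T" "subspace V"
  shows "almost_disjoint (seq_span Z) V"
proof -
  have "z \<in> span T" if z: "z \<in> seq_span Z" "z \<in> V" for z
  proof -
    obtain S r where S: "finite S" "S \<subseteq> range Z" "z = (\<Sum>a\<in>S. r a *s a)"
      using z(1) by (auto simp: seq_span_def span_explicit)
    then obtain I where I: "finite I" "S = Z ` I"
      by (meson finite_subset_image)
    then obtain n where "I \<subseteq> {..<n}"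
      using finite_nat_iff_bounded by blast
    then have "S \<subseteq> Z ` {..<n}"
      using I(2) by blast
    then have "z \<in> span (Z ` {..<n})"
      unfolding S(3) by (intro span_sum span_scale span_base) blast
    then show ?thesis
      using assms(1) z(2) by blast
  qed
  then have "seq_span Z \<inter> V \<subseteq> span T"
    by blast
  moreover have "subspace (seq_span Z \<inter> V)"
    using assms(3) subspace_seq_span subspace_inter by blast
  ultimately show ?thesis
    unfolding almost_disjoint_def using assms(2) fin_dim_iff by blast
qed

section \<open>A block sequence almost disjoint from a small family\<close>

text \<open>A condition records the union of a finite set of members of \<open>\<A>\<close> rather than the set itself: in
  this form a condition is coded by a subset of a countable set, hence by a real.\<close>

definition conditions :: "(nat \<Rightarrow> 'v) \<Rightarrow> 'v set set \<Rightarrow> ('v list \<times> 'v set) set"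
  where "conditions X \<A> = {(s, \<Union>\<F>) |s \<F>. sorted_wrt block_less s \<and> 0 \<notin> set s \<and>
    set s \<subseteq> seq_span X \<and> finite \<F> \<and> \<F> \<subseteq> \<A>}"

text \<open>The first component is a finite stem of the sequence to be built, the second a promise.
  By the last clause, a longer stem spans no vector of the promised set beyond those the old stem
  spanned, so the final span meets each promised member in finite dimension.\<close>

definition extends :: "'v list \<times> 'v set \<Rightarrow> 'v list \<times> 'v set \<Rightarrow> bool"
  where "extends p q \<longleftrightarrow> prefix (fst q) (fst p) \<and> snd q \<subseteq> snd p \<and>
    span (set (fst p)) \<inter> snd q \<subseteq> span (set (fst q))"

definition condition_order :: "(nat \<Rightarrow> 'v) \<Rightarrow> 'v set set \<Rightarrow> ('v list \<times> 'v set) rel"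
  where "condition_order X \<A> = {(p, q). p \<in> conditions X \<A> \<and> q \<in> conditions X \<A> \<and> extends p q}"

section \<open>The poset of conditions: order, sigma-centeredness and dense sets\<close>

lemma partial_order_conditions: "partial_order_on (conditions X \<A>) (condition_order X \<A>)"
  unfolding partial_order_on_def preorder_on_def
proof (intro conjI)
  show "condition_order X \<A> \<subseteq> conditions X \<A> \<times> conditions X \<A>"
    by (auto simp: condition_order_def)
  show "refl_on (conditions X \<A>) (condition_order X \<A>)"
    by (simp add: refl_on_def condition_order_def extends_def)
  have "extends p r" if "extends p q" "extends q r" for p q r
    using that prefix_order.trans[of "fst r" "fst q" "fst p"] unfolding extends_def by blast
  then show "trans (condition_order X \<A>)"
    unfolding condition_order_def trans_def by blast
  have "p = q" if "extends p q" "extends q p" for p q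
    using that by (simp add: extends_def prod_eq_iff prefix_order.eq_iff set_eq_subset)
  then show "antisym (condition_order X \<A>)"
    unfolding condition_order_def antisym_def by blast
qed

lemma conditions_Nil: "finite \<F> \<Longrightarrow> \<F> \<subseteq> \<A> \<Longrightarrow> ([], \<Union>\<F>) \<in> conditions X \<A>"
  unfolding conditions_def by (rule CollectI, intro exI[of _ "[]"] exI[of _ \<F>]) simp

lemma conditions_Un:
  assumes "(s, U) \<in> conditions X \<A>" "(s', U') \<in> conditions X \<A>"
  shows "(s, U \<union> U') \<in> conditions X \<A>"
proof -
  obtain \<F> \<F>' where "U = \<Union>\<F>" "U' = \<Union>\<F>'" "finite (\<F> \<union> \<F>')" "\<F> \<union> \<F>' \<subseteq> \<A>"
    and "sorted_wrt block_less s" "0 \<notin> set s" "set s \<subseteq> seq_span X"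
    using assms by (auto simp: conditions_def)
  then show ?thesis
    unfolding conditions_def by (metis (mono_tags, lifting) Union_Un_distrib mem_Collect_eq)
qed

text \<open>Finitely many conditions with the same stem are bounded by that stem with the union of
  their promises: an unchanged stem breaks no promise. There are only countably many stems.\<close>

lemma sigma_centered_conditions: "sigma_centered (conditions X \<A>) (condition_order X \<A>)"
proof -
  define C where "C s = {p \<in> conditions X \<A>. fst p = s}" for s
  have centered: "centered_in (conditions X \<A>) (condition_order X \<A>) (C s)" for s
    unfolding centered_in_def
  proof (intro conjI allI impI)
    show "C s \<subseteq> conditions X \<A>"
      by (auto simp: C_def)
  next
    fix S assume S: "S \<subseteq> C s \<and> finite S"
    show "\<exists>q\<in>conditions X \<A>. \<forall>p\<in>S. (q, p) \<in> condition_order X \<A>"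
    \<comment> \<open>The empty set needs a separate bound because \<open>C s\<close> is empty when
      \<open>s\<close> is not the stem of a condition.\<close>
    proof (cases "S = {}")
      case True
      have "([], \<Union>{}) \<in> conditions X \<A>"
        by (intro conditions_Nil) auto
      then show ?thesis
        using True by blast
    next
      case False
      have "(s, \<Union>(snd ` S)) \<in> conditions X \<A>" if "finite S" "S \<noteq> {}" "S \<subseteq> C s" for S
        using that
      proof (induction rule: finite_ne_induct)
        case (insert p S)
        then show ?case
          using conditions_Un[of s "snd p" X \<A> s "\<Union>(snd ` S)"] by (auto simp: C_def)
      qed (auto simp: C_def)
      then have "(s, \<Union>(snd ` S)) \<in> conditions X \<A>"
        using S False by blast
      moreover have "extends (s, \<Union>(snd ` S)) p" if "p \<in> S" for p
        using S that by (auto simp: extends_def C_def)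
      ultimately show ?thesis
        using S unfolding condition_order_def C_def by blast
    qed
  qed
  have "countable (UNIV :: 'v list set)"
    using countable_lists[OF countable_vectors] unfolding lists_UNIV .
  then obtain f :: "nat \<Rightarrow> 'v list" where "range f = UNIV"
    using range_from_nat_into[of "UNIV :: 'v list set"] by blast
  then have "conditions X \<A> = (\<Union>n. C (f n))"
    by (force simp: C_def)
  then show ?thesis
    unfolding sigma_centered_def using centered by (intro exI[of _ "\<lambda>n. C (f n)"]) blast
qed

text \<open>Here the coideal hypothesis enters the forcing argument: through
  \<open>coideal_extension\<close> every stem can be lengthened by one vector with all promises
  kept.\<close>

lemma dense_conditions_length:
  assumes "ad_family \<A>" "X \<in> coideal \<A>"
  shows "dense_in (conditions X \<A>) (condition_order X \<A>) {p \<in> conditions X \<A>. n \<le> length (fst p)}"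
  unfolding dense_in_def
proof (intro conjI ballI)
  have refl: "(p, p) \<in> condition_order X \<A>" if "p \<in> conditions X \<A>" for p
    using partial_order_conditions[of X \<A>] that
    by (auto simp: partial_order_on_def preorder_on_def refl_on_def)
  have trans: "trans (condition_order X \<A>)"
    using partial_order_conditions by (auto simp: partial_order_on_def preorder_on_def)
  have ext: "\<exists>q\<in>conditions X \<A>. length (fst q) = Suc (length (fst p)) \<and> (q, p) \<in> condition_order X \<A>"
    if p: "p \<in> conditions X \<A>" for p
  proof -
    obtain s \<F> where s: "p = (s, \<Union>\<F>)" "sorted_wrt block_less s" "0 \<notin> set s" "set s \<subseteq> seq_span X"
      and \<F>: "finite \<F>" "\<F> \<subseteq> \<A>"
      using p by (auto simp: conditions_def)
    have "finite (\<Union>y\<in>set s. supp y)"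
      using finite_supp by blast
    then obtain N where N: "(\<Union>y\<in>set s. supp y) \<subseteq> {..N}"
      using finite_nat_iff_bounded_le by blast
    obtain x where x: "x \<in> seq_span X" "x \<noteq> 0" "supp x \<subseteq> {N<..}"
      "\<And>V. V \<in> \<F> \<Longrightarrow> span (insert x (set s)) \<inter> V \<subseteq> span (set s)"
      using coideal_extension[OF assms \<F>, of "set s" N] by auto
    have "block_less y x" if "y \<in> set s" for y
      unfolding block_less_iff
    proof (intro conjI ballI)
      fix m n assume "m \<in> supp y" "n \<in> supp x"
      then have "m \<le> N" "N < n"
        using N x(3) that by auto
      then show "m < n" by simp
    qed (use x that s in auto)
    then have q: "(s @ [x], \<Union>\<F>) \<in> conditions X \<A>"
      using s \<F> x(1,2) unfolding conditions_def by (auto simp: sorted_wrt_append)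
    moreover have "extends (s @ [x], \<Union>\<F>) p"
      using x(4) by (auto simp: extends_def s(1))
    ultimately show ?thesis
      using p s(1) unfolding condition_order_def by (intro bexI[of _ "(s @ [x], \<Union>\<F>)"]) auto
  qed
  fix p assume p: "p \<in> conditions X \<A>"
  show "\<exists>q\<in>{p \<in> conditions X \<A>. n \<le> length (fst p)}. (q, p) \<in> condition_order X \<A>"
  proof (induction n)
    case 0
    then show ?case
      using p refl[OF p] by auto
  next
    case (Suc n)
    then obtain q where q: "q \<in> conditions X \<A>" "n \<le> length (fst q)" "(q, p) \<in> condition_order X \<A>"
      by blast
    then obtain q' where "q' \<in> conditions X \<A>" "length (fst q') = Suc (length (fst q))"
      "(q', q) \<in> condition_order X \<A>"
      using ext by blast
    then show ?case
      using q trans by (intro bexI[of _ q']) (auto dest: transD)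
  qed
qed auto

lemma dense_conditions_mem:
  assumes "V \<in> \<A>"
  shows "dense_in (conditions X \<A>) (condition_order X \<A>) {p \<in> conditions X \<A>. V \<subseteq> snd p}"
  unfolding dense_in_def
proof (intro conjI ballI)
  fix p assume p: "p \<in> conditions X \<A>"
  obtain s U where su: "p = (s, U)"
    by fastforce
  have "([], \<Union>{V}) \<in> conditions X \<A>"
    using assms by (intro conditions_Nil) auto
  then have "(s, U \<union> V) \<in> conditions X \<A>"
    using conditions_Un p su by fastforce
  moreover have "extends (s, U \<union> V) p"
    by (auto simp: su extends_def)
  ultimately show "\<exists>q\<in>{p \<in> conditions X \<A>. V \<subseteq> snd p}. (q, p) \<in> condition_order X \<A>"
    using p by (intro bexI[of _ "(s, U \<union> V)"]) (auto simp: condition_order_def)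
qed auto

text \<open>The stems in a sufficiently generic filter are initial segments of one sequence
  \<open>Z\<close>. The sets \<open>L n\<close> make it infinite, and the sets \<open>M V\<close>
  ensure that each \<open>V\<close> is eventually promised.\<close>

proposition MA_almost_disjoint_below:
  includes cardinal_syntax
  assumes "MA_sigma_centered" "ad_family \<A>" "|\<A>| <o |UNIV :: real set|" "X \<in> coideal \<A>"
  obtains Z where "Z \<in> bb" "Z \<preceq> X" "\<And>V. V \<in> \<A> \<Longrightarrow> almost_disjoint (seq_span Z) V"
proof -
  define P where "P = conditions X \<A>"
  define le where "le = condition_order X \<A>"
  define L where "L n = {p \<in> P. n \<le> length (fst p)}" for n
  define M where "M V = {p \<in> P. V \<subseteq> snd p}" for V
  have "countable (UNIV :: ('v list + 'v) set)"
    using countable_Plus[OF countable_lists[OF countable_vectors] countable_vectors]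
    unfolding lists_UNIV UNIV_Plus_UNIV .
  then obtain k :: "('v list + 'v) set \<Rightarrow> real" where k: "inj k"
    by (rule countable_sets_inj_real)
  \<comment> \<open>A condition is coded by a set in a disjoint sum, its stem being the only element
    tagged \<open>Inl\<close>.\<close>
  have "inj (\<lambda>p :: 'v list \<times> 'v set. k ({Inl (fst p)} \<union> Inr ` snd p))"
  proof (rule injI)
    fix p q :: "'v list \<times> 'v set"
    assume "k ({Inl (fst p)} \<union> Inr ` snd p) = k ({Inl (fst q)} \<union> Inr ` snd q)"
    then have "{Inl (fst p)} \<union> Inr ` snd p = {Inl (fst q)} \<union> Inr ` snd q"
      using k by (simp add: inj_eq)
    then have "fst p = fst q" "snd p = snd q"
      by (auto simp: set_eq_iff)
    then show "p = q"
      by (simp add: prod_eq_iff)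
  qed
  moreover have "|range L \<union> M ` \<A>| <o |UNIV :: real set|"
  proof (rule card_of_Un_ordLess_infinite)
    have "|range L| \<le>o |UNIV :: nat set|"
      by (rule card_of_image)
    also note nat_ordLess_real
    finally show "|range L| <o |UNIV :: real set|" .
    show "|M ` \<A>| <o |UNIV :: real set|"
      using card_of_image assms(3) ordLeq_ordLess_trans by blast
  qed (rule infinite_UNIV_char_0)
  moreover have "P \<noteq> {}"
    unfolding P_def using conditions_Nil[of "{}" \<A> X] by blast
  moreover have "dense_in P le (L n)" for n
    unfolding P_def le_def L_def by (rule dense_conditions_length[OF assms(2,4)])
  moreover have "dense_in P le (M V)" if "V \<in> \<A>" for V
    unfolding P_def le_def M_def using that by (rule dense_conditions_mem)
  moreover have "partial_order_on P le" "sigma_centered P le"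
    unfolding P_def le_def by (rule partial_order_conditions sigma_centered_conditions)+
  ultimately obtain G where G: "filter_in P le G" "\<And>D. D \<in> range L \<union> M ` \<A> \<Longrightarrow> G \<inter> D \<noteq> {}"
    by (elim MA_sigma_centered_transfer[OF assms(1), where P = P and le = le and \<D> = "range L \<union> M ` \<A>"]) auto
  have GP: "G \<subseteq> P"
    using G(1) by (simp add: filter_in_def)
  have common: "\<exists>r\<in>G. extends r p \<and> extends r q" if "p \<in> G" "q \<in> G" for p q
    using G(1) that unfolding filter_in_def le_def condition_order_def by blast
  have "\<exists>p\<in>G. n \<le> length (fst p)" for n
    using G(2)[of "L n"] by (auto simp: L_def)
  then obtain p where p: "\<And>n. p n \<in> G" "\<And>n. n \<le> length (fst (p n))"
    by metis
  \<comment> \<open>The stem of \<open>p (Suc n)\<close> has length greater than \<open>n\<close>,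
    so the index is in range.\<close>
  define Z where "Z n = fst (p (Suc n)) ! n" for n
  have prefix_nth: "ys ! n = xs ! n" if "prefix xs ys" "n < length xs" for xs ys :: "'v list" and n
    using that by (auto simp: prefix_def nth_append)
  \<comment> \<open>Two members of \<open>G\<close> have a common extension, whose stem prolongs
    both stems; hence the choice of \<open>p\<close> is immaterial.\<close>
  have nth: "fst q ! n = Z n" if q: "q \<in> G" "n < length (fst q)" for q n
  proof -
    obtain r where "prefix (fst q) (fst r)" "prefix (fst (p (Suc n))) (fst r)"
      using common[OF q(1) p(1)[of "Suc n"]] by (auto simp: extends_def)
    moreover have "n < length (fst (p (Suc n)))"
      using p(2)[of "Suc n"] by simp
    ultimately have "fst r ! n = fst q ! n" "fst r ! n = Z n"
      unfolding Z_def using q(2) prefix_nth by metis+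
    then show ?thesis
      by simp
  qed
  have condD: "sorted_wrt block_less (fst q) \<and> set (fst q) \<subseteq> seq_span X" if "q \<in> G" for q
  proof -
    have "q \<in> conditions X \<A>"
      using that GP by (auto simp: P_def)
    then show ?thesis
      by (auto simp: conditions_def)
  qed
  have "block_less (Z n) (Z (Suc n))" for n
  proof -
    have "Suc n < length (fst (p (Suc (Suc n))))"
      using p(2)[of "Suc (Suc n)"] by simp
    then show ?thesis
      using condD[OF p(1)[of "Suc (Suc n)"]] nth[OF p(1)]
      by (metis Suc_lessD lessI sorted_wrt_nth_less)
  qed
  then have "Z \<in> bb"
    by (simp add: bb_iff)
  moreover have "Z n \<in> seq_span X" for n
  proof -
    have "n < length (fst (p (Suc n)))"
      using p(2)[of "Suc n"] by simp
    then show ?thesis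
      using condD[OF p(1)[of "Suc n"]] unfolding Z_def by (meson nth_mem subsetD)
  qed
  then have "Z \<preceq> X"
    unfolding block_le_def seq_span_def[of Z]
    by (intro span_minimal subspace_seq_span) blast
  moreover have "almost_disjoint (seq_span Z) V" if V: "V \<in> \<A>" for V
  proof -
    \<comment> \<open>A common extension of \<open>p n\<close> and \<open>q\<close> keeps the
      promise of \<open>q\<close>, so the first \<open>n\<close> terms of \<open>Z\<close> span
      nothing in \<open>V\<close> outside \<open>span (set (fst q))\<close>, whatever
      \<open>n\<close> is.\<close>
    obtain q where q: "q \<in> G" "V \<subseteq> snd q"
      using G(2)[of "M V"] V by (auto simp: M_def)
    show ?thesis
    proof (rule almost_disjoint_seq_spanI)
      fix n
      obtain r where r: "extends r (p n)" "extends r q"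
        using common[OF p(1) q(1)] by blast
      have "Z ` {..<n} \<subseteq> set (fst (p n))"
        using nth[OF p(1)[of n]] p(2)[of n] by (metis image_subsetI lessThan_iff nth_mem order_less_le_trans)
      also have "\<dots> \<subseteq> set (fst r)"
        using r(1) by (simp add: extends_def set_mono_prefix)
      finally have "span (Z ` {..<n}) \<subseteq> span (set (fst r))"
        by (rule span_mono)
      then show "span (Z ` {..<n}) \<inter> V \<subseteq> span (set (fst q))"
        using r(2) q(2) by (auto simp: extends_def)
    qed (use V assms(2) block_subspaceD in \<open>auto simp: ad_family_def\<close>)
  qed
  ultimately show thesis
    by (rule that)
qed

section \<open>The recursion\<close>

text \<open>The implication lets a stage add nothing when no \<open>W\<close> exists. Placing
  \<open>Y\<close> in \<open>coideal \<S>\<close>, not merely in the coideal of the union, makes its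
  membership survive all later additions.\<close>

definition stage :: "'v set set \<Rightarrow> (nat \<Rightarrow> 'v) \<Rightarrow> 'v set \<Rightarrow> 'v set set \<Rightarrow> bool"
  where "stage \<A> X D \<S> \<longleftrightarrow> countable \<S> \<and> ad_family (\<A> \<union> \<S>) \<and>
    ((\<exists>W\<in>bb. W \<preceq> X \<and> (\<forall>V\<in>\<A>. almost_disjoint (seq_span W) V)) \<longrightarrow>
     (\<exists>Y\<in>coideal \<S>. Y \<preceq> X \<and> (seq_span Y \<subseteq> D \<or> \<not> (\<exists>Z\<in>bb. Z \<preceq> Y \<and> seq_span Z \<subseteq> D))))"

lemma stage_exists:
  assumes "ad_family \<A>"
  obtains \<S> where "stage \<A> X D \<S>"
proof (cases "\<exists>W\<in>bb. W \<preceq> X \<and> (\<forall>V\<in>\<A>. almost_disjoint (seq_span W) V)")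
  case False
  then have "stage \<A> X D {}"
    using assms by (auto simp: stage_def)
  then show thesis
    by (rule that)
next
  case True
  then obtain W where W: "W \<in> bb" "W \<preceq> X" "\<And>V. V \<in> \<A> \<Longrightarrow> almost_disjoint (seq_span W) V"
    by blast
  \<comment> \<open>\<open>Y\<close> is a block sequence below \<open>W\<close> with span inside
    \<open>D\<close> if there is one, and \<open>W\<close> itself otherwise.\<close>
  obtain Y where Y: "Y \<in> bb" "Y \<preceq> W"
    "seq_span Y \<subseteq> D \<or> \<not> (\<exists>Z\<in>bb. Z \<preceq> Y \<and> seq_span Z \<subseteq> D)"
    using W(1) unfolding block_le_def by blast
  obtain \<S> where \<S>: "countable \<S>" "infinite \<S>" "ad_family \<S>" "\<And>V. V \<in> \<S> \<Longrightarrow> V \<subseteq> seq_span Y"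
    using infinite_disjoint_pieces[OF Y(1)] by blast
  have "almost_disjoint V V'" if "V \<in> \<S>" "V' \<in> \<A>" for V V'
  proof (rule almost_disjoint_subset[OF W(3)[OF that(2)]])
    show "V \<subseteq> seq_span W"
      using \<S>(4)[OF that(1)] Y(2) by (auto simp: block_le_def)
  qed (use that assms \<S>(3) block_subspaceD in \<open>auto simp: ad_family_def\<close>)
  then have cross: "almost_disjoint V V' \<and> almost_disjoint V' V" if "V \<in> \<S>" "V' \<in> \<A>" for V V'
    using that almost_disjoint_commute by blast
  have "ad_family (\<A> \<union> \<S>)"
    unfolding ad_family_def
  proof (intro conjI ballI impI)
    fix V V' assume "V \<in> \<A> \<union> \<S>" "V' \<in> \<A> \<union> \<S>" "V \<noteq> V'"
    then show "almost_disjoint V V'"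
      using assms \<S>(3) cross unfolding ad_family_def by (elim UnE) auto
  qed (use assms \<S>(3) in \<open>auto simp: ad_family_def\<close>)
  moreover have "{V \<in> \<S>. \<not> fin_dim (seq_span Y \<inter> V)} = \<S>"
    using \<S>(3,4) block_subspaceD(2) unfolding ad_family_def by (auto simp: Int_absorb1)
  then have "Y \<in> coideal \<S>"
    using Y(1) \<S>(2) by (simp add: coideal_def)
  moreover have "Y \<preceq> X"
    using Y(2) W(2) by (auto simp: block_le_def)
  ultimately have "stage \<A> X D \<S>"
    using \<S>(1) Y(3) unfolding stage_def by blast
  then show thesis
    by (rule that)
qed

lemma coideal_mono: "\<S> \<subseteq> \<A> \<Longrightarrow> coideal \<S> \<subseteq> coideal \<A>"
  unfolding coideal_def by (auto elim!: infinite_super[rotated])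

section \<open>Enumerating the tasks by reals\<close>

lemma bb_nonempty: "bb \<noteq> {}"
proof -
  have "\<not> fin_dim UNIV"
  proof
    assume "fin_dim UNIV"
    then obtain T where "finite T" "span T = UNIV"
      by (auto simp: fin_dim_def)
    then have "finite (range e)"
      using independent_span_bound[OF _ independent_e] by blast
    then show False
      using inj_e finite_imageD infinite_UNIV_nat by blast
  qed
  then show ?thesis
    using infinite_dim_block_sequence[of UNIV] subspace_UNIV by blast
qed

text \<open>A task is coded by the graph of its sequence tagged \<open>Inl\<close> together with its
  set \<open>D\<close> tagged \<open>Inr\<close>. The injection into the reals is then turned into a
  surjection from them; repeated tasks do no harm.\<close>

lemma enumeration_tasks:
  obtains task :: "real \<Rightarrow> (nat \<Rightarrow> 'v) \<times> 'v set" where "range task = bb \<times> UNIV"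
proof -
  have "countable (UNIV :: (nat \<times> 'v) set)"
    using countable_SIGMA[of "UNIV :: nat set" "\<lambda>_. UNIV :: 'v set"] countable_vectors by simp
  from countable_Plus[OF this countable_vectors]
  have "countable (UNIV :: ((nat \<times> 'v) + 'v) set)"
    unfolding UNIV_Plus_UNIV .
  then obtain k :: "((nat \<times> 'v) + 'v) set \<Rightarrow> real" where k: "inj k"
    by (rule countable_sets_inj_real)
  let ?h = "\<lambda>t :: (nat \<Rightarrow> 'v) \<times> 'v set. k (range (\<lambda>n. Inl (n, fst t n)) \<union> Inr ` snd t)"
  have "inj ?h"
  proof (rule injI)
    fix p q :: "(nat \<Rightarrow> 'v) \<times> 'v set"
    assume "?h p = ?h q"
    then have *: "range (\<lambda>n. Inl (n, fst p n)) \<union> Inr ` snd p = range (\<lambda>n. Inl (n, fst q n)) \<union> Inr ` snd q"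
      using k by (simp add: inj_eq)
    have "fst p n = fst q n" for n
    proof -
      have "Inl (n, fst p n) \<in> range (\<lambda>n. Inl (n, fst q n)) \<union> Inr ` snd q"
        unfolding *[symmetric] by blast
      then show ?thesis
        by auto
    qed
    moreover have "snd p = snd q"
      using * by (auto simp: set_eq_iff image_iff)
    ultimately show "p = q"
      by (simp add: prod_eq_iff fun_eq_iff)
  qed
  then have "inj_on ?h (bb \<times> UNIV)"
    using inj_on_subset by blast
  moreover have "bb \<times> (UNIV :: 'v set set) \<noteq> {}"
    using bb_nonempty by blast
  ultimately obtain task :: "real \<Rightarrow> (nat \<Rightarrow> 'v) \<times> 'v set" where "range task = bb \<times> UNIV"
    using inj_on_iff_surj[of "bb \<times> UNIV" "UNIV :: real set"] by blast
  then show thesis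
    by (rule that)
qed

theorem full_mad_family_exists:
  assumes "MA_sigma_centered"
  obtains \<A> where "full_mad_family \<A>"
proof -
  include cardinal_syntax
  \<comment> \<open>A well-order of the reals of minimal type: each proper initial segment has fewer
    than continuum many elements.\<close>
  define r where "r = |UNIV :: real set|"
  have r: "Card_order r" "Well_order r" "Field r = UNIV"
    unfolding r_def by (rule card_of_Card_order card_of_Well_order Field_card_of)+
  have wf: "wf (r - Id)"
    using r(2) by (simp add: well_order_on_def)
  have underS: "b \<in> underS r a \<longleftrightarrow> (b, a) \<in> r - Id" for a b
    by (auto simp: underS_def)
  have "Total r"
    using r(2) by (auto simp: order_on_defs)
  obtain task :: "real \<Rightarrow> (nat \<Rightarrow> 'v) \<times> 'v set" where task: "range task = bb \<times> UNIV"
    by (rule enumeration_tasks)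
  have task_surj: "\<exists>a. task a = (X, D)" if "X \<in> bb" for X D
  proof -
    have "(X, D) \<in> range task"
      unfolding task using that by simp
    then show ?thesis
      by (metis imageE)
  qed
  \<comment> \<open>The premise \<open>ad_family \<A>\<close> makes a choice possible for arbitrary
    \<open>f\<close>; that it holds along the actual recursion is shown afterwards by
    induction.\<close>
  define P where "P f a \<S> \<longleftrightarrow> (let \<A> = \<Union> (f ` underS r a) in
    ad_family \<A> \<longrightarrow> stage \<A> (fst (task a)) (snd (task a)) \<S>)" for f a \<S>
  have "\<exists>S. \<forall>a. P S a (S a)"
  proof (rule dependent_wf_choice[OF wf])
    fix f g :: "real \<Rightarrow> 'v set set" and a \<S>
    assume "\<And>b. (b, a) \<in> r - Id \<Longrightarrow> f b = g b"
    then have "f ` underS r a = g ` underS r a"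
      using underS by (intro image_cong) auto
    then show "P f a \<S> = P g a \<S>"
      by (simp add: P_def)
  next
    fix a f
    show "\<exists>\<S>. P f a \<S>"
      unfolding P_def Let_def using stage_exists by metis
  qed
  then obtain S where S: "\<And>a. P S a (S a)"
    by blast
  define prev where "prev a = \<Union> (S ` underS r a)" for a
  \<comment> \<open>Of two members, the one chosen later has the other in its \<open>prev\<close>,
    or they share a stage; either way one stage sees both.\<close>
  have ad_Union: "ad_family (\<Union> (S ` I))" if "\<And>a. a \<in> I \<Longrightarrow> ad_family (prev a \<union> S a)" for I
    unfolding ad_family_def
  proof (intro conjI ballI impI)
    fix V assume "V \<in> \<Union> (S ` I)"
    then show "block_subspace V"
      using that by (auto simp: ad_family_def)
  next
    fix V W assume VW: "V \<in> \<Union> (S ` I)" "W \<in> \<Union> (S ` I)" "V \<noteq> W"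
    then obtain a b where ab: "a \<in> I" "V \<in> S a" "b \<in> I" "W \<in> S b"
      by blast
    consider "a = b" | "a \<in> underS r b" | "b \<in> underS r a"
      using \<open>Total r\<close> r(3) by (auto simp: total_on_def underS)
    then have "\<exists>c\<in>I. V \<in> prev c \<union> S c \<and> W \<in> prev c \<union> S c"
      using ab by cases (auto simp: prev_def)
    then show "almost_disjoint V W"
      using that VW(3) unfolding ad_family_def by blast
  qed
  have ad_upto: "ad_family (prev a \<union> S a)" for a
    using wf
  proof (induction a rule: wf_induct_rule)
    case (less a)
    have "ad_family (\<Union> (S ` underS r a))"
      using less underS by (intro ad_Union) blast
    then have "ad_family (prev a)"
      by (simp add: prev_def)
    then show ?case
      using S[of a] by (simp add: P_def stage_def prev_def)
  qed
  have ad_prev: "ad_family (prev a)" for a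
    unfolding prev_def by (intro ad_Union ad_upto)
  then have stage: "stage (prev a) (fst (task a)) (snd (task a)) (S a)" for a
    using S[of a] by (simp add: P_def prev_def)
  define \<A> where "\<A> = (\<Union>a. S a)"
  have ad: "ad_family \<A>"
    unfolding \<A>_def by (intro ad_Union ad_upto)
  have prev_subset: "prev a \<subseteq> \<A>" and S_subset: "S a \<subseteq> \<A>" for a
    by (auto simp: \<A>_def prev_def)
  have small: "|prev a| <o |UNIV :: real set|" for a
  proof -
    \<comment> \<open>The summand \<open>nat\<close> keeps the bound infinite at finite positions
      and also bounds each countable \<open>S b\<close>.\<close>
    define B where "B = underS r a <+> (UNIV :: nat set)"
    have "|B| <o |UNIV :: real set|"
      unfolding B_def
    proof (rule card_of_Plus_ordLess_infinite)
      show "|underS r a| <o |UNIV :: real set|"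
        using card_of_underS[OF r(1)] r(3) r_def by simp
    qed (rule nat_ordLess_real infinite_UNIV_char_0)+
    moreover have "|prev a| \<le>o |B|"
      unfolding prev_def
    proof (rule card_of_UNION_ordLeq_infinite)
      show "infinite B"
        by (simp add: B_def)
      show "|underS r a| \<le>o |B|"
        unfolding B_def by (rule card_of_Plus1)
      have "|S b| \<le>o |UNIV :: nat set|" for b
        using stage[of b] card_of_ordLeq[of "S b" "UNIV :: nat set"]
        by (auto simp: stage_def countable_def)
      moreover have "|UNIV :: nat set| \<le>o |B|"
        unfolding B_def by (rule card_of_Plus2)
      ultimately show "\<forall>b\<in>underS r a. |S b| \<le>o |B|"
        using ordLeq_transitive by blast
    qed
    ultimately show ?thesis
      using ordLeq_ordLess_trans by blast
  qed
  have decided: "\<exists>Y\<in>coideal \<A>. Y \<preceq> X \<and> (seq_span Y \<subseteq> D \<or> \<not> (\<exists>Z\<in>bb. Z \<preceq> Y \<and> seq_span Z \<subseteq> D))"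
    if X: "X \<in> coideal \<A>" for X D
  proof -
    have "X \<in> bb"
      using X by (simp add: coideal_def)
    then obtain a where a: "task a = (X, D)"
      using task_surj by blast
    have "\<exists>W\<in>bb. W \<preceq> X \<and> (\<forall>V\<in>prev a. almost_disjoint (seq_span W) V)"
    proof (cases "X \<in> coideal (prev a)")
      case True
      then show ?thesis
        using MA_almost_disjoint_below[OF assms ad_prev small True] by metis
    next
      case False
      then have "finite {V \<in> prev a. \<not> fin_dim (seq_span X \<inter> V)}"
        using \<open>X \<in> bb\<close> by (simp add: coideal_def)
      moreover have "infinite {V \<in> \<A>. \<not> fin_dim (seq_span X \<inter> V)}"
        using X by (simp add: coideal_def)
      ultimately have "\<not> {V \<in> \<A>. \<not> fin_dim (seq_span X \<inter> V)}
          \<subseteq> {V \<in> prev a. \<not> fin_dim (seq_span X \<inter> V)}"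
        using finite_subset by blast
      \<comment> \<open>Being added at stage \<open>a\<close> or later, \<open>V\<close> is almost
        disjoint from every member of \<open>prev a\<close>, and so is any block sequence inside
        it.\<close>
      then obtain V where V: "V \<in> \<A>" "V \<notin> prev a" "\<not> fin_dim (seq_span X \<inter> V)"
        by blast
      have sub: "subspace U" if "U \<in> \<A>" for U
        using ad that block_subspaceD by (auto simp: ad_family_def)
      obtain W where W: "W \<in> bb" "seq_span W \<subseteq> seq_span X \<inter> V"
        using infinite_dim_block_sequence[OF _ V(3)] sub[OF V(1)] subspace_seq_span subspace_inter
        by metis
      have "almost_disjoint (seq_span W) U" if "U \<in> prev a" for U
      proof (rule almost_disjoint_subset)
        have "U \<in> \<A>" "V \<noteq> U"
          using that prev_subset V by auto
        then show "almost_disjoint V U" "subspace U"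
          using ad V(1) sub by (auto simp: ad_family_def)
      qed (use W(2) subspace_seq_span in auto)
      then show ?thesis
        using W by (auto simp: block_le_def)
    qed
    then have "\<exists>Y\<in>coideal (S a). Y \<preceq> X \<and>
        (seq_span Y \<subseteq> D \<or> \<not> (\<exists>Z\<in>bb. Z \<preceq> Y \<and> seq_span Z \<subseteq> D))"
      using stage[of a] unfolding stage_def a fst_conv snd_conv by (elim conjE mp)
    then show ?thesis
      using coideal_mono[OF S_subset[of a]] by (meson subsetD)
  qed
  \<comment> \<open>At the stage of the task \<open>(X, UNIV)\<close>, \<open>X\<close> itself
    serves as \<open>W\<close>.\<close>
  have piece_below: "\<exists>a. \<exists>Y\<in>coideal (S a). Y \<preceq> X"
    if X: "X \<in> bb" "\<And>V. V \<in> \<A> \<Longrightarrow> almost_disjoint (seq_span X) V" for X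
  proof -
    obtain a where a: "task a = (X, UNIV)"
      using task_surj X(1) by blast
    have "\<exists>W\<in>bb. W \<preceq> X \<and> (\<forall>V\<in>prev a. almost_disjoint (seq_span W) V)"
      using X prev_subset[of a] by (intro bexI[of _ X]) (auto simp: block_le_def)
    then have "\<exists>Y\<in>coideal (S a). Y \<preceq> X \<and>
        (seq_span Y \<subseteq> UNIV \<or> \<not> (\<exists>Z\<in>bb. Z \<preceq> Y \<and> seq_span Z \<subseteq> UNIV))"
      using stage[of a] unfolding stage_def a fst_conv snd_conv by (elim conjE mp)
    then show ?thesis
      by blast
  qed
  have "infinite \<A>"
  proof -
    \<comment> \<open>At the least stage nothing has been chosen, so almost disjointness is vacuous
      and infinitely many members are added whatever the task is.\<close>
    obtain a where "\<And>b. (b, a) \<notin> r - Id"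
      using wfE_min[OF wf, of 0 UNIV] by (metis UNIV_I)
    then have a: "prev a = {}"
      by (auto simp: prev_def underS_def)
    have X: "fst (task a) \<in> bb"
      using rangeI[of task a] unfolding task by auto
    have "\<exists>W\<in>bb. W \<preceq> fst (task a) \<and> (\<forall>V\<in>prev a. almost_disjoint (seq_span W) V)"
      using X a by (intro bexI[of _ "fst (task a)"]) (auto simp: block_le_def)
    then obtain Y where "Y \<in> coideal (S a)"
      using stage[of a] unfolding stage_def by blast
    then have "infinite {V \<in> S a. \<not> fin_dim (seq_span Y \<inter> V)}"
      by (simp add: coideal_def)
    moreover have "{V \<in> S a. \<not> fin_dim (seq_span Y \<inter> V)} \<subseteq> \<A>"
      using S_subset by blast
    ultimately show ?thesis
      by (rule infinite_super[rotated])
  qed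
  moreover have "mad_family \<A>"
    unfolding mad_family_def
  proof (intro conjI notI ad)
    assume "\<exists>\<B>. ad_family \<B> \<and> \<A> \<subset> \<B>"
    then obtain \<B> V where \<B>: "ad_family \<B>" "\<A> \<subset> \<B>" "V \<in> \<B>" "V \<notin> \<A>"
      by blast
    have V: "almost_disjoint V U" if "U \<in> \<A>" for U
    proof -
      have "U \<in> \<B>" "V \<noteq> U"
        using that \<B> by auto
      then show ?thesis
        using \<B>(1,3) by (simp add: ad_family_def)
    qed
    obtain X where X: "X \<in> bb" "V = seq_span X"
      using \<B>(1,3) unfolding ad_family_def block_subspace_def by blast
    then have "\<exists>a. \<exists>Y\<in>coideal (S a). Y \<preceq> X"
      using V by (intro piece_below) simp_all
    then obtain a Y where Y: "Y \<in> coideal (S a)" "Y \<preceq> X"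
      by blast
    then have "{U \<in> S a. \<not> fin_dim (seq_span Y \<inter> U)} \<noteq> {}"
      by (intro infinite_imp_nonempty) (simp add: coideal_def)
    then obtain U where U: "U \<in> S a" "\<not> fin_dim (seq_span Y \<inter> U)"
      by blast
    then have "U \<in> \<A>"
      using S_subset by blast
    have "almost_disjoint (seq_span Y) U"
    proof (rule almost_disjoint_subset[OF V[OF \<open>U \<in> \<A>\<close>] subspace_seq_span])
      show "seq_span Y \<subseteq> V"
        using Y(2) X(2) by (simp add: block_le_def)
      show "subspace U"
        using ad \<open>U \<in> \<A>\<close> block_subspaceD by (auto simp: ad_family_def)
    qed
    then show False
      using U(2) by (simp add: almost_disjoint_def)
  qed
  moreover have "full (coideal \<A>)"
    \<comment> \<open>The hypothesis of fullness, applied to the \<open>Y\<close> from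
      \<open>decided\<close>, excludes its second alternative, so \<open>Y\<close> is the
      witness.\<close>
    unfolding full_def restrict_below_def using decided by blast
  ultimately show thesis
    by (intro that) (simp add: full_mad_family_def)
qed

end

theorem theorem4p12:
  fixes scale :: "'f::field \<Rightarrow> 'v::ab_group_add \<Rightarrow> 'v"
    and e :: "nat \<Rightarrow> 'v"
  assumes "MA_sigma_centered"
    and "countable_based_space scale e"
  shows "\<exists>\<A>. countable_based_space.full_mad_family scale e \<A>"
  using countable_based_space.full_mad_family_exists[OF assms(2,1)] by blast

end
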